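(* Let $p$ be a prime and let $A,B,C\subset \mathbb{F}_p^*$ be nonempty sets. Then $$|AB|\cdot|(A+1)C|\gg \min\Bigl\{p\,|A|,\ \frac{|A|^2\cdot|B|\cdot|C|}{p}\Bigr\},$$ where the implied constant is absolute.
   Context: $\mathbb{F}_p$ is the field with $p$ elements and $\mathbb{F}_p^*=\mathbb{F}_p\setminus\{0\}$. For sets $X,Y$, $XY=\{xy: x\in X, y\in Y\}$ and $X+1=\{x+1:x\in X\}$. The notation $U\gg V$ means $U\ge cV$ for some absolute constant $c>0$. *)

theory Defs
  imports Complex_Main "HOL-Number_Theory.Residues"
begin

(* The constant in the theorem must not depend on p, so p has to be quantified inside the
   formula; this rules out a type-indexed prime field. *)
abbreviation Fp :: "nat \<Rightarrow> int ring" where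
  "Fp p \<equiv> residue_ring (int p)"

abbreviation Fp_star :: "nat \<Rightarrow> int set" where
  "Fp_star p \<equiv> carrier (Fp p) - {\<zero>\<^bsub>Fp p\<^esub>}"

abbreviation plus_one :: "nat \<Rightarrow> int set \<Rightarrow> int set" where
  "plus_one p X \<equiv> (\<lambda>x. x \<oplus>\<^bsub>Fp p\<^esub> \<one>\<^bsub>Fp p\<^esub>) ` X"

end

theory Submission
  imports Defs "HOL-Analysis.Convex"
begin

text \<open>
  For \<open>a \<in> A\<close>, \<open>b \<in> B\<close>, \<open>c \<in> C\<close> the point \<open>(ab, (a+1)c)\<close> of \<open>AB \<times> (A+1)C\<close> lies on the line
  \<open>y = c (x/b + 1)\<close>. The \<open>|B||C|\<close> lines obtained this way are distinct, so there are at least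
  \<open>|A||B||C|\<close> incidences between the point set \<open>AB \<times> (A+1)C\<close> and these lines. On the other hand,
  the number of lines through a random point of the plane has mean \<open>|L|/p\<close> and, since two
  lines meet at most once, variance at most \<open>|L|/p\<close>; by Cauchy-Schwarz the number of incidences
  is at most \<open>|P||L|/p + sqrt (p|P||L|)\<close>. Comparing the two bounds gives the theorem.
\<close>

section \<open>Incidence counting by second moments\<close>

text \<open>Double counting, with an arbitrary relation \<open>I\<close> because it is applied both
  to lines and to ordered pairs of lines.\<close>

lemma sum_card_incident_swap:
  assumes "finite Q" "finite L"
  shows "(\<Sum>q\<in>Q. card {l\<in>L. I q l}) = (\<Sum>l\<in>L. card {q\<in>Q. I q l})"
proof -
  have "(\<Sum>q\<in>Q. card {l\<in>L. I q l}) = (\<Sum>q\<in>Q. \<Sum>l\<in>L. if I q l then 1 else 0)"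
    using assms by (simp add: sum.If_cases Int_def)
  also have "\<dots> = (\<Sum>l\<in>L. \<Sum>q\<in>Q. if I q l then 1 else 0)"
    by (rule sum.swap)
  also have "\<dots> = (\<Sum>l\<in>L. card {q\<in>Q. I q l})"
    using assms by (simp add: sum.If_cases Int_def)
  finally show ?thesis .
qed

text \<open>The second moment counts ordered pairs of lines through a common point: it is at most
  k|L| + |L|^2, and centring at the mean |L|/k removes the |L|^2.\<close>

lemma incidence_variance:
  fixes I :: "'q \<Rightarrow> 'l \<Rightarrow> bool" and k :: nat
  assumes fin: "finite Q" "finite L" and k: "k > 0" and Q: "card Q = k\<^sup>2"
    and line: "\<And>l. l \<in> L \<Longrightarrow> card {q\<in>Q. I q l} = k"
    and meet: "\<And>l l'. l \<in> L \<Longrightarrow> l' \<in> L \<Longrightarrow> l \<noteq> l' \<Longrightarrow> card {q\<in>Q. I q l \<and> I q l'} \<le> 1"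
  shows "(\<Sum>q\<in>Q. (real (card {l\<in>L. I q l}) - real (card L) / real k)\<^sup>2) \<le> real k * real (card L)"
proof -
  define f where "f q = card {l\<in>L. I q l}" for q
  have f1: "(\<Sum>q\<in>Q. f q) = k * card L"
    unfolding f_def using line by (simp add: sum_card_incident_swap[OF fin])
  have "(f q)\<^sup>2 = card {l\<in>L \<times> L. I q (fst l) \<and> I q (snd l)}" for q
  proof -
    have "{l\<in>L \<times> L. I q (fst l) \<and> I q (snd l)} = {l\<in>L. I q l} \<times> {l\<in>L. I q l}" by auto
    then show ?thesis by (simp add: f_def power2_eq_square card_cartesian_product)
  qed
  then have "(\<Sum>q\<in>Q. (f q)\<^sup>2) = (\<Sum>l\<in>L \<times> L. card {q\<in>Q. I q (fst l) \<and> I q (snd l)})"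
    using sum_card_incident_swap[of Q "L \<times> L" "\<lambda>q l. I q (fst l) \<and> I q (snd l)"] fin
    by simp
  also have "\<dots> = (\<Sum>l\<in>L. \<Sum>l'\<in>L. card {q\<in>Q. I q l \<and> I q l'})"
    by (simp add: sum.cartesian_product case_prod_beta)
  \<comment> \<open>Diagonal pairs are bounded by k + 1 instead of k, so that the summand 1 runs
    over all pairs and gives exactly |L|^2.\<close>
  also have "\<dots> \<le> (\<Sum>l\<in>L. \<Sum>l'\<in>L. (if l' = l then k else 0) + 1)"
    using line meet by (intro sum_mono) (auto simp: le_Suc_eq)
  also have "\<dots> = k * card L + (card L)\<^sup>2"
    using fin by (simp only: sum.distrib) (simp add: power2_eq_square)
  finally have f2: "(\<Sum>q\<in>Q. (real (f q))\<^sup>2) \<le> real k * real (card L) + (real (card L))\<^sup>2"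
    by (metis (mono_tags, lifting) of_nat_le_iff of_nat_add of_nat_mult of_nat_power of_nat_sum sum.cong)
  have f1': "(\<Sum>q\<in>Q. real (f q)) = real k * real (card L)"
    by (metis f1 of_nat_mult of_nat_sum)
  have "(\<Sum>q\<in>Q. (real (f q) - real (card L) / real k)\<^sup>2)
      = (\<Sum>q\<in>Q. (real (f q))\<^sup>2) - 2 * (real (card L) / real k) * (\<Sum>q\<in>Q. real (f q))
        + real (card Q) * (real (card L) / real k)\<^sup>2"
    by (simp add: power2_diff sum.distrib sum_subtractf sum_distrib_left sum_divide_distrib algebra_simps)
  \<comment> \<open>The cross term is -2|L|^2; the constant term is |L|^2 because Q has k^2
    points.\<close>
  also have "\<dots> = (\<Sum>q\<in>Q. (real (f q))\<^sup>2) - (real (card L))\<^sup>2"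
    using k by (simp add: f1' Q field_simps power2_eq_square)
  finally show ?thesis using f2 by (simp add: f_def)
qed

text \<open>Cauchy-Schwarz against the constant 1 on \<open>P\<close>; the sum of squares is then
  enlarged from \<open>P\<close> to \<open>Q\<close>, where the variance bound applies.\<close>

lemma incidence_bound:
  fixes I :: "'q \<Rightarrow> 'l \<Rightarrow> bool" and k :: nat
  assumes fin: "finite Q" "finite L" and k: "k > 0" and Q: "card Q = k\<^sup>2"
    and line: "\<And>l. l \<in> L \<Longrightarrow> card {q\<in>Q. I q l} = k"
    and meet: "\<And>l l'. l \<in> L \<Longrightarrow> l' \<in> L \<Longrightarrow> l \<noteq> l' \<Longrightarrow> card {q\<in>Q. I q l \<and> I q l'} \<le> 1"
    and P: "P \<subseteq> Q"
  shows "(real (\<Sum>q\<in>P. card {l\<in>L. I q l}) - real (card P) * real (card L) / real k)\<^sup>2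
    \<le> real k * real (card P) * real (card L)"
proof -
  define g where "g q = real (card {l\<in>L. I q l}) - real (card L) / real k" for q
  have "(\<Sum>q\<in>P. g q)\<^sup>2 \<le> (\<Sum>q\<in>P. 1\<^sup>2) * (\<Sum>q\<in>P. (g q)\<^sup>2)"
    using Cauchy_Schwarz_ineq_sum[of "\<lambda>_. 1" g P] by simp
  also have "\<dots> = real (card P) * (\<Sum>q\<in>P. (g q)\<^sup>2)" by simp
  also have "\<dots> \<le> real (card P) * (\<Sum>q\<in>Q. (g q)\<^sup>2)"
    using P fin by (intro mult_left_mono sum_mono2) auto
  also have "\<dots> \<le> real (card P) * (real k * real (card L))"
    unfolding g_def using assms by (intro mult_left_mono incidence_variance) auto
  finally show ?thesis
    by (simp add: g_def sum_subtractf algebra_simps)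
qed

section \<open>Lines in the plane over the prime field\<close>

text \<open>The pair \<open>(b, c)\<close> encodes the line \<open>y = c (x/b + 1)\<close>; clearing the denominator avoids modular inverses.\<close>

definition on_line :: "int \<Rightarrow> int \<times> int \<Rightarrow> int \<times> int \<Rightarrow> bool" where
  "on_line p q l \<longleftrightarrow> [fst l * snd q = snd l * (fst q + fst l)] (mod p)"

lemma cong_residues_imp_eq:
  fixes x y p :: int
  assumes "[x = y] (mod p)" "x \<in> {0..<p}" "y \<in> {0..<p}"
  shows "x = y"
  using assms cong_less_imp_eq_int[of x p y] by simp

lemma coprime_prime_residue:
  fixes b p :: int
  assumes "prime p" "b \<in> {0<..<p}"
  shows "coprime b p"
proof -
  have "\<not> p dvd b" using assms(2) zdvd_not_zless by auto
  then show ?thesis using assms(1) prime_imp_coprime coprime_commute by blast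
qed

lemma cong_cancel_prime:
  fixes b x y p :: int
  assumes "prime p" "b \<in> {0<..<p}" "[b * x = b * y] (mod p)"
  shows "[x = y] (mod p)"
  using assms coprime_prime_residue cong_mult_lcancel by blast

text \<open>Since b is invertible modulo p, the line is the graph of a function of x defined on all
  residues.\<close>

lemma card_on_line:
  fixes p :: nat
  assumes p: "prime p" and l: "l \<in> {0<..<int p} \<times> {0<..<int p}"
  shows "card {q \<in> {0..<int p} \<times> {0..<int p}. on_line (int p) q l} = p"
proof -
  obtain b c where l': "l = (b, c)" "b \<in> {0<..<int p}" "c \<in> {0<..<int p}" using l by auto
  have pp: "prime (int p)" "int p > 0" using p by (auto simp: prime_gt_0_nat)
  obtain b' where b': "[b * b' = 1] (mod int p)" 
    using coprime_prime_residue[OF pp(1) l'(2)] cong_solve_coprime_int by blast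
  define h where "h x = (b' * (c * (x + b))) mod int p" for x
  have h: "[b * h x = c * (x + b)] (mod int p)" for x
  proof -
    have "[b * h x = (b * b') * (c * (x + b))] (mod int p)"
      by (simp add: h_def cong_def mod_simps mult.assoc)
    also have "[(b * b') * (c * (x + b)) = 1 * (c * (x + b))] (mod int p)"
      by (intro cong_mult b' cong_refl)
    finally show ?thesis by simp
  qed
  have "y = h x" if "y \<in> {0..<int p}" "[b * y = c * (x + b)] (mod int p)" for x y
  proof (rule cong_residues_imp_eq)
    show "[y = h x] (mod int p)"
      by (rule cong_cancel_prime[OF pp(1) l'(2)]) (meson h that(2) cong_trans cong_sym)
    show "h x \<in> {0..<int p}" using pp by (simp add: h_def)
  qed (use that in simp)
  then have "{q \<in> {0..<int p} \<times> {0..<int p}. on_line (int p) q l} = (\<lambda>x. (x, h x)) ` {0..<int p}"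
    using h pp by (auto simp: on_line_def l' h_def)
  moreover have "inj_on (\<lambda>x. (x, h x)) {0..<int p}" by (auto simp: inj_on_def)
  ultimately show ?thesis by (simp add: card_image)
qed

text \<open>Two common points have equal abscissas unless the slopes c/b and c'/b' agree; parallel
  lines with a common point have equal intercepts c and c', hence coincide.\<close>

lemma card_on_two_lines_le_1:
  fixes p :: nat
  assumes p: "prime p" and l: "l \<in> {0<..<int p} \<times> {0<..<int p}"
    and l': "l' \<in> {0<..<int p} \<times> {0<..<int p}" and ne: "l \<noteq> l'"
  shows "card {q \<in> {0..<int p} \<times> {0..<int p}. on_line (int p) q l \<and> on_line (int p) q l'} \<le> 1"
    (is "card ?S \<le> 1")
proof -
  obtain b c b' c' where lc: "l = (b, c)" "b \<in> {0<..<int p}" "c \<in> {0<..<int p}"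
      "l' = (b', c')" "b' \<in> {0<..<int p}" "c' \<in> {0<..<int p}"
    using l l' by auto
  have pp: "prime (int p)" using p by simp
  have nd: "\<not> int p dvd z" if "z \<in> {0<..<int p}" for z using that zdvd_not_zless by auto
  have "u = v" if u: "u \<in> ?S" and v: "v \<in> ?S" for u v
  proof -
    obtain x y where xy: "u = (x, y)" "x \<in> {0..<int p}" "y \<in> {0..<int p}" using u by auto
    obtain z w where zw: "v = (z, w)" "z \<in> {0..<int p}" "w \<in> {0..<int p}" using v by auto
    have d1: "int p dvd b * y - c * (x + b)" and d2: "int p dvd b' * y - c' * (x + b')"
      and d3: "int p dvd b * w - c * (z + b)" and d4: "int p dvd b' * w - c' * (z + b')"
      using u v by (auto simp: on_line_def xy zw lc cong_iff_dvd_diff)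
    \<comment> \<open>This combination eliminates both ordinates and leaves the slope difference,
      cleared of denominators, times the difference of abscissas.\<close>
    have "int p dvd b' * ((b * y - c * (x + b)) - (b * w - c * (z + b)))
        - b * ((b' * y - c' * (x + b')) - (b' * w - c' * (z + b')))"
      by (intro dvd_diff[OF dvd_mult dvd_mult] dvd_diff d1 d2 d3 d4)
    also have "\<dots> = (c' * b - c * b') * (x - z)" by (simp add: algebra_simps)
    finally have "int p dvd c' * b - c * b' \<or> int p dvd x - z"
      using pp prime_dvd_mult_iff by blast
    moreover have False if par: "int p dvd c' * b - c * b'"
    proof -
      \<comment> \<open>With equal slopes, eliminating y at a single common point leaves a unit
        times the difference of the intercepts.\<close>
      have "int p dvd b' * (b * y - c * (x + b)) - b * (b' * y - c' * (x + b'))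
          - x * (c' * b - c * b')"
        by (intro dvd_diff[OF dvd_diff[OF dvd_mult dvd_mult] dvd_mult] d1 d2 par)
      also have "\<dots> = b * (b' * (c' - c))" by (simp add: algebra_simps)
      finally have "int p dvd c' - c"
        using pp nd lc by (meson prime_dvd_mult_iff)
      then have "c' = c"
        using lc by (intro cong_residues_imp_eq[of _ _ "int p"]) (auto simp: cong_iff_dvd_diff)
      moreover from this par have "int p dvd c * (b - b')" by (simp add: right_diff_distrib)
      then have "int p dvd b - b'"
        using pp nd lc by (meson prime_dvd_mult_iff)
      then have "b = b'"
        using lc by (intro cong_residues_imp_eq[of _ _ "int p"]) (auto simp: cong_iff_dvd_diff)
      ultimately show False using ne lc by simp
    qed
    ultimately have "int p dvd x - z" by blast
    then have xz: "x = z"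
      using xy zw by (intro cong_residues_imp_eq[of _ _ "int p"]) (auto simp: cong_iff_dvd_diff)
    have "int p dvd (b * y - c * (x + b)) - (b * w - c * (z + b))"
      using d1 d3 by (rule dvd_diff)
    also have "\<dots> = b * (y - w)" by (simp add: xz algebra_simps)
    finally have "int p dvd y - w" using pp nd lc by (meson prime_dvd_mult_iff)
    then have "y = w"
      using xy zw by (intro cong_residues_imp_eq[of _ _ "int p"]) (auto simp: cong_iff_dvd_diff)
    with xz show "u = v" by (simp add: xy zw)
  qed
  \<comment> \<open>The criterion by pairwise equality is for finite sets; for an infinite set
    \<open>card\<close> has the default value 0.\<close>
  then show ?thesis by (metis (no_types, lifting) One_nat_def card_le_Suc0_iff_eq card.infinite le0)
qed

section \<open>From products to incidences, and the comparison of the bounds\<close>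

text \<open>A triple (a, b, c) is sent to an incident point-line pair. This is injective: the line
  gives b and c, and a is recovered from ab because b is invertible.\<close>

lemma card_products_le_incidences:
  fixes p :: nat and A B C X Y :: "int set"
  assumes p: "prime p"
    and A: "A \<subseteq> {0<..<int p}" and B: "B \<subseteq> {0<..<int p}" and C: "C \<subseteq> {0<..<int p}"
    and X: "finite X" "\<And>a b. a \<in> A \<Longrightarrow> b \<in> B \<Longrightarrow> (a * b) mod int p \<in> X"
    and Y: "finite Y" "\<And>a c. a \<in> A \<Longrightarrow> c \<in> C \<Longrightarrow> ((a + 1) * c) mod int p \<in> Y"
  shows "card A * (card B * card C) \<le> (\<Sum>q\<in>X \<times> Y. card {l\<in>B \<times> C. on_line (int p) q l})"
proof -
  have fin: "finite A" "finite B" "finite C" using A B C by (auto intro: finite_subset)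
  have pp: "prime (int p)" using p by simp
  define T where "T = (SIGMA q:X \<times> Y. {l\<in>B \<times> C. on_line (int p) q l})"
  define F where "F = (\<lambda>(a, b, c). (((a * b) mod int p, ((a + 1) * c) mod int p), (b, c)))"
  have "inj_on F (A \<times> B \<times> C)"
  proof (rule inj_onI)
    fix u v assume "u \<in> A \<times> B \<times> C" "v \<in> A \<times> B \<times> C" and eq: "F u = F v"
    then obtain a b c a' b' c' where uv: "u = (a, b, c)" "v = (a', b', c')"
      "a \<in> A" "a' \<in> A" "b \<in> B" by auto
    with eq have e: "b' = b" "c' = c" "[b * a = b * a'] (mod int p)"
      by (auto simp: F_def cong_def mult.commute)
    have "[a = a'] (mod int p)"
      using cong_cancel_prime[OF pp _ e(3)] B uv by blast
    then have "a = a'" using A uv by (intro cong_residues_imp_eq[of _ _ "int p"]) force+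
    then show "u = v" using uv e by simp
  qed
  moreover have "F ` (A \<times> B \<times> C) \<subseteq> T"
  proof -
    have "[b * (((a + 1) * c) mod int p) = c * ((a * b) mod int p + b)] (mod int p)" for a b c
    proof -
      have "b * ((a + 1) * c) = c * (a * b + b)" by (simp add: algebra_simps)
      then show ?thesis unfolding cong_def by (metis mod_add_left_eq mod_mult_right_eq)
    qed
    then show ?thesis using X Y by (auto simp: F_def T_def on_line_def)
  qed
  moreover have "finite T" using X Y fin by (auto simp: T_def)
  ultimately have "card (A \<times> B \<times> C) \<le> card T" by (metis card_inj_on_le)
  also have "card T = (\<Sum>q\<in>X \<times> Y. card {l\<in>B \<times> C. on_line (int p) q l})"
    unfolding T_def using X Y fin by (intro card_SigmaI) auto
  finally show ?thesis by (simp add: card_cartesian_product)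
qed

text \<open>Here \<open>M\<close> stands for the number of points, \<open>l\<close> for the number
  of lines, \<open>a\<close> for |A| and \<open>S\<close> for the number of incidences. If M < pa/4,
  the main term Ml/p is at most a quarter of al, so the error term must account for the rest of
  \<open>S\<close>.\<close>

lemma min_le_of_incidence_bound:
  fixes S M a l p :: real
  assumes p: "p > 0" and l: "l > 0" and a: "a > 0"
    and S: "a * l \<le> S" and bound: "(S - M * l / p)\<^sup>2 \<le> p * M * l"
  shows "1/4 * min (p * a) (a\<^sup>2 * l / p) \<le> M"
proof (cases "p * a / 4 \<le> M")
  case True
  then show ?thesis by (simp add: min_def)
next
  case False
  then have "M * l / p \<le> a * l / 4"
    using p l by (simp add: field_simps)
  \<comment> \<open>The difference is even at least 3al/4; the weaker al/2 squares to the factor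
    1/4, the constant of the other case.\<close>
  then have "a * l / 2 \<le> S - M * l / p" using S mult_pos_pos[OF a l] by linarith
  then have "(a * l / 2)\<^sup>2 \<le> (S - M * l / p)\<^sup>2"
    using a l by (intro power_mono) auto
  with bound have "l * (a\<^sup>2 * l / 4) \<le> l * (p * M)"
    by (simp add: power2_eq_square algebra_simps)
  then have "a\<^sup>2 * l / 4 \<le> p * M" using l by simp
  then have "a\<^sup>2 * l / p / 4 \<le> M" using p by (simp add: field_simps)
  then show ?thesis by (simp add: min_def)
qed

text \<open>The incidence bound is applied with the whole plane as \<open>Q\<close> and k = p. The
  range of \<open>Y\<close> includes 0, which occurs as (a + 1)c when a = p - 1.\<close>

lemma card_products_lower_bound:
  fixes p :: nat and A B C X Y :: "int set"
  assumes p: "prime p"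
    and A: "A \<subseteq> {0<..<int p}" "A \<noteq> {}" and B: "B \<subseteq> {0<..<int p}" "B \<noteq> {}"
    and C: "C \<subseteq> {0<..<int p}" "C \<noteq> {}"
    and X: "X \<subseteq> {0..<int p}" "\<And>a b. a \<in> A \<Longrightarrow> b \<in> B \<Longrightarrow> (a * b) mod int p \<in> X"
    and Y: "Y \<subseteq> {0..<int p}" "\<And>a c. a \<in> A \<Longrightarrow> c \<in> C \<Longrightarrow> ((a + 1) * c) mod int p \<in> Y"
  shows "1/4 * min (real p * real (card A)) ((real (card A))\<^sup>2 * real (card B) * real (card C) / real p)
    \<le> real (card X) * real (card Y)"
proof -
  have fin: "finite A" "finite B" "finite C" "finite X" "finite Y"
    using A(1) B(1) C(1) X(1) Y(1) by (auto intro: finite_subset)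
  define S where "S = (\<Sum>q\<in>X \<times> Y. card {l\<in>B \<times> C. on_line (int p) q l})"
  have "card A * (card B * card C) \<le> S"
    unfolding S_def using p A(1) B(1) C(1) fin(4) X(2) fin(5) Y(2)
    by (rule card_products_le_incidences)
  then have S: "real (card A) * (real (card B) * real (card C)) \<le> real S"
    by (metis of_nat_le_iff of_nat_mult)
  have BC: "l \<in> {0<..<int p} \<times> {0<..<int p}" if "l \<in> B \<times> C" for l using that B C by blast
  have "(real S - real (card (X \<times> Y)) * real (card (B \<times> C)) / real p)\<^sup>2
      \<le> real p * real (card (X \<times> Y)) * real (card (B \<times> C))"
    unfolding S_def
  proof (rule incidence_bound)
    show "finite ({0..<int p} \<times> {0..<int p})" "finite (B \<times> C)" using fin by auto
    show "card ({0..<int p} \<times> {0..<int p}) = p\<^sup>2"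
      by (simp add: card_cartesian_product power2_eq_square)
    show "X \<times> Y \<subseteq> {0..<int p} \<times> {0..<int p}" using X Y by blast
  qed (use p BC in \<open>simp_all add: prime_gt_0_nat card_on_line card_on_two_lines_le_1 del: One_nat_def\<close>)
  then have "1/4 * min (real p * real (card A)) ((real (card A))\<^sup>2 * (real (card B) * real (card C)) / real p)
      \<le> real (card X) * real (card Y)"
    using p A B C fin S
    by (intro min_le_of_incidence_bound[where S = "real S"])
       (auto simp: card_cartesian_product prime_gt_0_nat card_gt_0_iff mult.assoc)
  then show ?thesis by (simp add: mult.assoc)
qed

theorem theorem2:
  shows "\<exists>c::real. c > 0 \<and>
    (\<forall>(p::nat) (A::int set) (B::int set) (C::int set).
       prime p \<longrightarrow>
       A \<subseteq> Fp_star p \<longrightarrow> B \<subseteq> Fp_star p \<longrightarrow> C \<subseteq> Fp_star p \<longrightarrow>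
       A \<noteq> {} \<longrightarrow> B \<noteq> {} \<longrightarrow> C \<noteq> {} \<longrightarrow>
       real (card (A <#>\<^bsub>Fp p\<^esub> B)) * real (card (plus_one p A <#>\<^bsub>Fp p\<^esub> C))
         \<ge> c * min (real p * real (card A))
                   ((real (card A))\<^sup>2 * real (card B) * real (card C) / real p))"
proof (intro exI[of _ "1/4"] conjI allI impI)
  fix p :: nat and A B C :: "int set"
  assume p: "prime p" and sub: "A \<subseteq> Fp_star p" "B \<subseteq> Fp_star p" "C \<subseteq> Fp_star p"
    and ne: "A \<noteq> {}" "B \<noteq> {}" "C \<noteq> {}"
  have p1: "int p > 1" using p prime_gt_1_nat by simp
  \<comment> \<open>The ring operations are translated into integer arithmetic modulo p on
    intervals.\<close>
  have star: "Fp_star p = {0<..<int p}" by (auto simp: residue_ring_def)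
  have mult: "x \<otimes>\<^bsub>Fp p\<^esub> y = (x * y) mod int p" for x y by (simp add: residue_ring_def)
  have add: "x \<oplus>\<^bsub>Fp p\<^esub> \<one>\<^bsub>Fp p\<^esub> = (x + 1) mod int p" for x by (simp add: residue_ring_def)
  show "1/4 * min (real p * real (card A)) ((real (card A))\<^sup>2 * real (card B) * real (card C) / real p)
      \<le> real (card (A <#>\<^bsub>Fp p\<^esub> B)) * real (card (plus_one p A <#>\<^bsub>Fp p\<^esub> C))"
  proof (rule card_products_lower_bound)
    show "A <#>\<^bsub>Fp p\<^esub> B \<subseteq> {0..<int p}" "plus_one p A <#>\<^bsub>Fp p\<^esub> C \<subseteq> {0..<int p}"
      using p1 by (auto simp: set_mult_def mult)
    show "(a * b) mod int p \<in> A <#>\<^bsub>Fp p\<^esub> B" if "a \<in> A" "b \<in> B" for a b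
      using that by (auto simp: set_mult_def mult)
    \<comment> \<open>In the ring, a + 1 is reduced before the multiplication by c; the residue of
      the product is the same.\<close>
    show "((a + 1) * c) mod int p \<in> plus_one p A <#>\<^bsub>Fp p\<^esub> C" if "a \<in> A" "c \<in> C" for a c
      using that by (auto simp: set_mult_def mult add mod_mult_left_eq)
  qed (use p sub ne star in simp_all)
qed simp

end
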